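(* Let $\Omega\subset\mathbb{R}^N$ be a bounded domain satisfying both the uniform exterior sphere condition and the uniform interior sphere condition, and let $u_0\in C_0(\bar\Omega)$ with $u_0\ge 0$ and $u_0\not\equiv 0$. Let $u$ be the (unique nonnegative) viscosity solution to $$\partial_t u = \Delta_\infty u \ \text{ in } (0,\infty)\times\Omega, \qquad u = 0 \ \text{ on } (0,\infty)\times\partial\Omega, \qquad u(0,x)=u_0(x) \ \text{ for } x\in\bar\Omega .$$ Then there is $t_1\in(0,\infty)$ such that $$u(t,x)>0 \qquad\text{for all } (t,x)\in[t_1,\infty)\times\Omega .$$
   Context: Notation. $B(x,r)=\{y\in\mathbb{R}^N : |y-x|<r\}$; $C_0(\bar\Omega)=\{f\in C(\bar\Omega): f=0 \text{ on }\partial\Omega\}$; $\mathcal{S}(N)$ is the set of symmetric real $N\times N$ matrices; $USC$ and $LSC$ denote upper and lower semicontinuous real-valued functions. The infinity-Laplacian is $\Delta_\infty u = \langle D^2u\,\nabla u,\nabla u\rangle = \sum_{i,j} \frac{\partial^2 u}{\partial x_i\partial x_j}\frac{\partial u}{\partial x_i}\frac{\partial u}{\partial x_j}$. Uniform exterior sphere condition: there is $R>0$ such that for every $x_0\in\partial\Omega$ there is $y_0\in\mathbb{R}^N$ with $|x_0-y_0|=R$ and $B(y_0,R)\cap\Omega=\emptyset$. Uniform interior sphere condition: there is $R_0>0$ such that for every $x_0\in\partial\Omega$ there is $y_0\in\Omega$ with $|y_0-x_0|=R_0$ and $B(y_0,R_0)\subset\Omega$. Parabolic viscosity solutions. Let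 $Q=(0,\infty)\times\Omega$. For $(t_0,x_0)\in Q$, $\mathcal{P}^{2,+}u(t_0,x_0)$ is the set of $(s,p,X)\in\mathbb{R}\times\mathbb{R}^N\times\mathcal{S}(N)$ such that $u(t,x)\le u(t_0,x_0)+s(t-t_0)+\langle p,x-x_0\rangle+\frac12\langle X(x-x_0),x-x_0\rangle+o(|t-t_0|+|x-x_0|^2)$ as $(t,x)\to(t_0,x_0)$, and $\mathcal{P}^{2,-}u(t_0,x_0)=-\mathcal{P}^{2,+}(-u)(t_0,x_0)$. A function $u\in USC(\bar Q)$ is a viscosity subsolution of the initial-boundary value problem if $s-\langle Xp,p\rangle\le 0$ for all $(s,p,X)\in\mathcal{P}^{2,+}u(t_0,x_0)$ and all $(t_0,x_0)\in Q$, $u\le 0$ on $(0,\infty)\times\partial\Omega$, and $u(0,x)\le u_0(x)$ for $x\in\bar\Omega$. A function $u\in LSC(\bar Q)$ is a viscosity supersolution if $s-\langle Xp,p\rangle\ge 0$ for all $(s,p,X)\in\mathcal{P}^{2,-}u(t_0,x_0)$ and all $(t_0,x_0)\in Q$, $u\ge 0$ on $(0,\infty)\times\partial\Omega$, and $u(0,x)\ge u_0(x)$ for $x\in\bar\Omega$. A viscosity solution is a function $u\in C(\bar Q)$ that is both. It is known that, under the stated assumptions on $\Omega$ and $u_0$, there is a unique nonnegative viscosity solution. *)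

theory Defs
  imports "HOL-Analysis.Analysis" "HOL-Library.Landau_Symbols"
begin

definition C0_closure :: "(real^'n) set \<Rightarrow> (real^'n \<Rightarrow> real) set" where
  "C0_closure \<Omega> = {f. continuous_on (closure \<Omega>) f \<and> (\<forall>x\<in>frontier \<Omega>. f x = 0)}"

definition uniform_exterior_sphere :: "(real^'n) set \<Rightarrow> bool" where
  "uniform_exterior_sphere \<Omega> \<longleftrightarrow>
     (\<exists>R>0. \<forall>x0\<in>frontier \<Omega>. \<exists>y0. dist x0 y0 = R \<and> ball y0 R \<inter> \<Omega> = {})"

definition uniform_interior_sphere :: "(real^'n) set \<Rightarrow> bool" where
  "uniform_interior_sphere \<Omega> \<longleftrightarrow>
     (\<exists>R0>0. \<forall>x0\<in>frontier \<Omega>. \<exists>y0\<in>\<Omega>. dist y0 x0 = R0 \<and> ball y0 R0 \<subseteq> \<Omega>)"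

definition usc_on :: "'a::topological_space set \<Rightarrow> ('a \<Rightarrow> real) \<Rightarrow> bool" where
  "usc_on S f \<longleftrightarrow> (\<forall>x\<in>S. \<forall>c>f x. \<forall>\<^sub>F y in at x within S. f y < c)"

definition lsc_on :: "'a::topological_space set \<Rightarrow> ('a \<Rightarrow> real) \<Rightarrow> bool" where
  "lsc_on S f \<longleftrightarrow> (\<forall>x\<in>S. \<forall>c<f x. \<forall>\<^sub>F y in at x within S. c < f y)"

text \<open>Space-time points are pairs \<open>(t, x)\<close>.\<close>

definition cylinder :: "(real^'n) set \<Rightarrow> (real \<times> (real^'n)) set" where
  "cylinder \<Omega> = {0<..} \<times> \<Omega>"

text \<open>The parabolic superjet of second order, relative to the set \<open>Q\<close> on which \<open>u\<close> is considered;
  the function \<open>r\<close> is the remainder term.\<close>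

definition parabolic_superjet ::
  "(real \<times> (real^'n)) set \<Rightarrow> (real \<times> (real^'n) \<Rightarrow> real) \<Rightarrow> real \<times> (real^'n)
     \<Rightarrow> (real \<times> (real^'n) \<times> (real^'n^'n)) set" where
  "parabolic_superjet Q u = (\<lambda>(t0, x0).
     {(s, p, X). transpose X = X \<and>
        (\<exists>r \<in> o[at (t0, x0) within Q](\<lambda>(t, x). \<bar>t - t0\<bar> + (norm (x - x0))\<^sup>2).
           \<forall>\<^sub>F (t, x) in at (t0, x0) within Q.
             u (t, x) \<le> u (t0, x0) + s * (t - t0) + p \<bullet> (x - x0)
                        + 1/2 * ((X *v (x - x0)) \<bullet> (x - x0)) + r (t, x))})"

definition parabolic_subjet ::
  "(real \<times> (real^'n)) set \<Rightarrow> (real \<times> (real^'n) \<Rightarrow> real) \<Rightarrow> real \<times> (real^'n)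
     \<Rightarrow> (real \<times> (real^'n) \<times> (real^'n^'n)) set" where
  "parabolic_subjet Q u z0 = uminus ` parabolic_superjet Q (\<lambda>z. - u z) z0"

text \<open>The infinity-Laplacian \<open>\<langle>D\<^sup>2u \<nabla>u, \<nabla>u\<rangle>\<close> as a function of gradient and Hessian.\<close>

definition infinity_laplacian_op :: "real^'n \<Rightarrow> real^'n^'n \<Rightarrow> real" where
  "infinity_laplacian_op p X = (X *v p) \<bullet> p"

text \<open>Solutions of \<open>\<partial>\<^sub>t u = \<Delta>\<^sub>\<infinity> u\<close> in the cylinder, with zero lateral boundary values and
  initial value \<open>u0\<close>. Only the values of \<open>u\<close> on the closed cylinder matter.\<close>

definition viscosity_subsolution ::
  "(real^'n) set \<Rightarrow> (real^'n \<Rightarrow> real) \<Rightarrow> (real \<times> (real^'n) \<Rightarrow> real) \<Rightarrow> bool" where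
  "viscosity_subsolution \<Omega> u0 u \<longleftrightarrow>
     usc_on (closure (cylinder \<Omega>)) u \<and>
     (\<forall>z\<in>cylinder \<Omega>. \<forall>(s, p, X) \<in> parabolic_superjet (cylinder \<Omega>) u z.
        s - infinity_laplacian_op p X \<le> 0) \<and>
     (\<forall>t>0. \<forall>x\<in>frontier \<Omega>. u (t, x) \<le> 0) \<and>
     (\<forall>x\<in>closure \<Omega>. u (0, x) \<le> u0 x)"

definition viscosity_supersolution ::
  "(real^'n) set \<Rightarrow> (real^'n \<Rightarrow> real) \<Rightarrow> (real \<times> (real^'n) \<Rightarrow> real) \<Rightarrow> bool" where
  "viscosity_supersolution \<Omega> u0 u \<longleftrightarrow>
     lsc_on (closure (cylinder \<Omega>)) u \<and>
     (\<forall>z\<in>cylinder \<Omega>. \<forall>(s, p, X) \<in> parabolic_subjet (cylinder \<Omega>) u z.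
        s - infinity_laplacian_op p X \<ge> 0) \<and>
     (\<forall>t>0. \<forall>x\<in>frontier \<Omega>. u (t, x) \<ge> 0) \<and>
     (\<forall>x\<in>closure \<Omega>. u (0, x) \<ge> u0 x)"

definition viscosity_solution ::
  "(real^'n) set \<Rightarrow> (real^'n \<Rightarrow> real) \<Rightarrow> (real \<times> (real^'n) \<Rightarrow> real) \<Rightarrow> bool" where
  "viscosity_solution \<Omega> u0 u \<longleftrightarrow>
     continuous_on (closure (cylinder \<Omega>)) u \<and>
     viscosity_subsolution \<Omega> u0 u \<and> viscosity_supersolution \<Omega> u0 u"

end

theory Submission
  imports Defs
begin

text \<open>Positivity on a ball spreads to every larger concentric ball inside \<open>\<Omega>\<close>: compare \<open>u\<close> with the
  subsolution \<open>g(t) (S(t) - |x - y|\<^sup>2)\<^sub>+\<^bsup>3/2\<^esup>\<close>, where \<open>g = q\<^bsup>-1/2\<^esup>\<close> for an affine \<open>q\<close> and \<open>S\<close> grows like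
  \<open>ln q\<close>. The exponent \<open>3/2\<close> is the one for which time derivative and infinity-Laplacian have the same
  order \<open>(S - |x - y|\<^sup>2)\<^bsup>1/2\<^esup>\<close> at the moving front. A slower growth of \<open>S\<close> is also admissible, so the
  larger ball is positive at every time after a waiting time that depends only on the two radii and on
  the initial lower bound. As the barrier is smooth wherever it is positive, comparison needs no doubling
  of variables. Chaining balls through the connected set \<open>\<Omega>\<close> gives a common time from which on \<open>u\<close> is
  positive on a compact core; the interior balls of the sphere condition are then filled from the core.\<close>

section \<open>Parabolic Taylor expansions and subjets\<close>

text \<open>A two-sided expansion at a single point stands in for smoothness of a test function:
  touching from below uses no more than this, and for an explicit barrier it can be verified by
  algebra.\<close>

definition parabolic_taylor ::
  "(real \<times> (real^'n) \<Rightarrow> real) \<Rightarrow> real \<Rightarrow> real^'n \<Rightarrow> real \<Rightarrow> real^'n \<Rightarrow> real^'n^'n \<Rightarrow> bool" where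
  "parabolic_taylor \<phi> t0 x0 s p X \<longleftrightarrow> transpose X = X \<and>
     (\<lambda>(t, x). \<phi> (t, x) - \<phi> (t0, x0) - s * (t - t0) - p \<bullet> (x - x0)
                - 1/2 * ((X *v (x - x0)) \<bullet> (x - x0)))
       \<in> o[at (t0, x0)](\<lambda>(t, x). \<bar>t - t0\<bar> + (norm (x - x0))\<^sup>2)"

lemma matrix_vector_mult_minus_left: "(- X) *v x = - (X *v x)" for X :: "real^'n^'m"
  by (simp add: matrix_vector_mult_def vec_eq_iff sum_negf)

text \<open>Inserting the expansion of \<open>\<phi>\<close> into the negated touching inequality
  gives the superjet inequality for \<open>- u\<close>, with minus the Taylor remainder as
  \<open>r\<close>. Passing from the full neighbourhood to \<open>Q\<close> only shrinks the
  filter.\<close>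

lemma parabolic_subjet_if_touching:
  fixes x0 :: "real^'n"
  assumes "parabolic_taylor \<phi> t0 x0 s p X"
    and "\<forall>\<^sub>F z in at (t0, x0). u (t0, x0) + \<phi> z - \<phi> (t0, x0) \<le> u z"
  shows "(s, p, X) \<in> parabolic_subjet Q u (t0, x0)"
proof -
  let ?E = "\<lambda>(t, x). \<phi> (t, x) - \<phi> (t0, x0) - s * (t - t0) - p \<bullet> (x - x0)
                - 1/2 * ((X *v (x - x0)) \<bullet> (x - x0))"
  let ?n = "\<lambda>(t, x). \<bar>t - t0\<bar> + (norm (x - x0))\<^sup>2"
  have le: "at (t0, x0) within Q \<le> at (t0, x0)"
    by (rule at_le) simp
  have X: "transpose X = X" and "?E \<in> o[at (t0, x0)](?n)"
    using assms(1) by (auto simp: parabolic_taylor_def)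
  then have "(\<lambda>z. - ?E z) \<in> o[at (t0, x0) within Q](?n)"
    using landau_o.small.filter_mono[OF le] by (subst landau_o.small.uminus_in_iff) blast
  moreover have "\<forall>\<^sub>F (t, x) in at (t0, x0) within Q.
      - u (t, x) \<le> - u (t0, x0) + (- s) * (t - t0) + (- p) \<bullet> (x - x0)
         + 1/2 * (((- X) *v (x - x0)) \<bullet> (x - x0)) + (- ?E (t, x))"
    using filter_leD[OF le assms(2)]
    by eventually_elim (auto simp: matrix_vector_mult_minus_left)
  moreover have "transpose (- X) = - X"
    using X by (simp add: transpose_def vec_eq_iff)
  ultimately have "(- s, - p, - X) \<in> parabolic_superjet Q (\<lambda>z. - u z) (t0, x0)"
    by (auto simp: parabolic_superjet_def intro!: bexI[where x = "\<lambda>z. - ?E z"])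
  then show ?thesis
    unfolding parabolic_subjet_def by (force intro: image_eqI[where x = "(- s, - p, - X)"])
qed

lemma smallo_if_bounded_by_null_factor:
  fixes f n :: "'a \<Rightarrow> real"
  assumes "(M \<longlongrightarrow> 0) F" and "\<forall>\<^sub>F z in F. \<bar>f z\<bar> \<le> M z * \<bar>n z\<bar>"
  shows "f \<in> o[F](n)"
proof (rule landau_o.smallI)
  fix c :: real assume "c > 0"
  then have "\<forall>\<^sub>F z in F. M z < c"
    using assms(1) by (simp add: order_tendstoD(2))
  then show "\<forall>\<^sub>F z in F. norm (f z) \<le> c * norm (n z)"
    using assms(2) by eventually_elim (smt (verit) abs_ge_zero mult_right_mono real_norm_def)
qed

text \<open>Caratheodory's slope function. With it the Taylor remainders below become exact
  identities whose coefficients are continuous and vanish at the base point.\<close>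

lemma DERIV_obtain_factor:
  assumes "(f has_real_derivative f') (at t0)"
  obtains \<gamma> where "\<And>t. f t = f t0 + \<gamma> t * (t - t0)" "isCont \<gamma> t0" "\<gamma> t0 = f'"
proof -
  obtain \<gamma> where \<gamma>: "\<forall>t. f t - f t0 = \<gamma> t * (t - t0)" "isCont \<gamma> t0" "\<gamma> t0 = f'"
    using assms unfolding CARAT_DERIV by blast
  then have "f t = f t0 + \<gamma> t * (t - t0)" for t
    by (metis add.commute diff_add_cancel)
  with \<gamma> that show thesis
    by blast
qed

lemma isCont_compose_fst:
  "isCont f t0 \<Longrightarrow> isCont (\<lambda>z. f (fst z)) (t0, x0)"
  by (rule isCont_o2[where f = fst]) auto

text \<open>A term in \<open>t\<close> alone shifts the time slope and leaves gradient and Hessian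
  unchanged; the comparison argument adds its penalty this way.\<close>

lemma parabolic_taylor_add_time:
  fixes x0 :: "real^'n"
  assumes "parabolic_taylor \<phi> t0 x0 s p X" and "(k has_real_derivative k') (at t0)"
  shows "parabolic_taylor (\<lambda>(t, x). \<phi> (t, x) + k t) t0 x0 (s + k') p X"
proof -
  let ?n = "\<lambda>(t, x::real^'n). \<bar>t - t0\<bar> + (norm (x - x0))\<^sup>2"
  obtain \<kappa> where \<kappa>: "\<And>t. k t = k t0 + \<kappa> t * (t - t0)" "isCont \<kappa> t0" "\<kappa> t0 = k'"
    by (rule DERIV_obtain_factor[OF assms(2)]) (rule that)
  have "((\<lambda>z. \<bar>\<kappa> (fst z) - k'\<bar>) \<longlongrightarrow> 0) (at (t0, x0))"
  proof -
    have "isCont (\<lambda>z::real \<times> (real^'n). \<bar>\<kappa> (fst z) - k'\<bar>) (t0, x0)"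
      using \<kappa>(2) by (intro continuous_intros isCont_compose_fst)
    then show ?thesis
      using \<kappa>(3) by (simp add: isCont_def)
  qed
  then have "(\<lambda>(t, x::real^'n). k t - k t0 - k' * (t - t0)) \<in> o[at (t0, x0)](?n)"
  proof (rule smallo_if_bounded_by_null_factor, intro always_eventually allI)
    fix z :: "real \<times> (real^'n)"
    have "k (fst z) - k t0 - k' * (fst z - t0) = (\<kappa> (fst z) - k') * (fst z - t0)"
      by (subst \<kappa>(1)) (simp add: algebra_simps)
    then show "\<bar>case z of (t, x) \<Rightarrow> k t - k t0 - k' * (t - t0)\<bar>
        \<le> \<bar>\<kappa> (fst z) - k'\<bar> * \<bar>case z of (t, x) \<Rightarrow> \<bar>t - t0\<bar> + (norm (x - x0))\<^sup>2\<bar>"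
      by (cases z) (auto simp: abs_mult intro!: mult_left_mono)
  qed
  moreover have "transpose X = X" and "(\<lambda>(t, x). \<phi> (t, x) - \<phi> (t0, x0) - s * (t - t0)
      - p \<bullet> (x - x0) - 1/2 * ((X *v (x - x0)) \<bullet> (x - x0))) \<in> o[at (t0, x0)](?n)"
    using assms(1) by (auto simp: parabolic_taylor_def)
  ultimately have "(\<lambda>z. (case z of (t, x) \<Rightarrow> \<phi> (t, x) - \<phi> (t0, x0) - s * (t - t0)
      - p \<bullet> (x - x0) - 1/2 * ((X *v (x - x0)) \<bullet> (x - x0)))
      + (case z of (t, x) \<Rightarrow> k t - k t0 - k' * (t - t0))) \<in> o[at (t0, x0)](?n)"
    by (intro sum_in_smallo(1))
  also have "(\<lambda>z. (case z of (t, x) \<Rightarrow> \<phi> (t, x) - \<phi> (t0, x0) - s * (t - t0)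
      - p \<bullet> (x - x0) - 1/2 * ((X *v (x - x0)) \<bullet> (x - x0)))
      + (case z of (t, x) \<Rightarrow> k t - k t0 - k' * (t - t0)))
      = (\<lambda>(t, x). (case (t, x) of (t, x) \<Rightarrow> \<phi> (t, x) + k t) - (case (t0, x0) of (t, x) \<Rightarrow> \<phi> (t, x) + k t)
          - (s + k') * (t - t0) - p \<bullet> (x - x0) - 1/2 * ((X *v (x - x0)) \<bullet> (x - x0)))"
    by (auto simp: fun_eq_iff algebra_simps)
  finally show ?thesis
    using \<open>transpose X = X\<close> by (simp only: parabolic_taylor_def simp_thms)
qed

text \<open>The matrix \<open>\<alpha> I + \<beta> \<xi> \<xi>^T\<close>, which is the shape of the
  Hessian of a radial function at offset \<open>\<xi>\<close> from its centre.\<close>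

definition rank_one_perturbation :: "real \<Rightarrow> real \<Rightarrow> real^'n \<Rightarrow> real^'n^'n" where
  "rank_one_perturbation \<alpha> \<beta> \<xi> = (\<chi> i j. (if j = i then \<alpha> else 0) + \<beta> * (\<xi> $ i * \<xi> $ j))"

lemma rank_one_perturbation_mult:
  "rank_one_perturbation \<alpha> \<beta> \<xi> *v h = \<alpha> *\<^sub>R h + (\<beta> * (\<xi> \<bullet> h)) *\<^sub>R \<xi>"
proof -
  have "(rank_one_perturbation \<alpha> \<beta> \<xi> *v h) $ i = \<alpha> * h $ i + (\<beta> * (\<xi> \<bullet> h)) * \<xi> $ i" for i
  proof -
    have "(rank_one_perturbation \<alpha> \<beta> \<xi> *v h) $ i
        = (\<Sum>j\<in>UNIV. (if j = i then \<alpha> * h $ j else 0) + (\<beta> * \<xi> $ i) * (\<xi> $ j * h $ j))"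
      unfolding rank_one_perturbation_def matrix_vector_mult_def vec_lambda_beta
      by (intro sum.cong) (auto simp: algebra_simps)
    also have "\<dots> = \<alpha> * h $ i + (\<beta> * \<xi> $ i) * (\<xi> \<bullet> h)"
      by (simp only: sum.distrib sum_distrib_left[symmetric] inner_vec_def inner_real_def) simp
    finally show ?thesis
      by (simp add: algebra_simps)
  qed
  then show ?thesis
    by (simp add: vec_eq_iff)
qed

lemma transpose_rank_one_perturbation:
  "transpose (rank_one_perturbation \<alpha> \<beta> \<xi>) = rank_one_perturbation \<alpha> \<beta> \<xi>"
  by (auto simp: rank_one_perturbation_def transpose_def vec_eq_iff mult.commute)

lemma norm_add_squared:
  "(norm (a + b))\<^sup>2 = (norm a)\<^sup>2 + 2 * (a \<bullet> b) + (norm b)\<^sup>2"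
  by (simp add: power2_norm_eq_inner inner_add inner_commute)

text \<open>A pointwise chain rule: the second-order expansion of \<open>F\<close> at
  \<open>w\<close> is composed with the increment of \<open>S t - |x - y|^2\<close>. As
  \<open>c\<close> is half the second derivative of \<open>F\<close>, the rank-one part of the
  Hessian carries the factor 8.\<close>

lemma parabolic_taylor_radial:
  fixes y x0 :: "real^'n"
  assumes g: "(g has_real_derivative g') (at t0)" and S: "(S has_real_derivative S') (at t0)"
    and w: "w = S t0 - (norm (x0 - y))\<^sup>2"
    and F: "\<And>\<sigma>. F \<sigma> = a + b * (\<sigma> - w) + (c + \<epsilon> \<sigma>) * (\<sigma> - w)\<^sup>2"
    and \<epsilon>: "isCont \<epsilon> w" "\<epsilon> w = 0"
    and X: "X = rank_one_perturbation (- 2 * g t0 * b) (8 * g t0 * c) (x0 - y)"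
  shows "parabolic_taylor (\<lambda>(t, x). g t * F (S t - (norm (x - y))\<^sup>2)) t0 x0
           (g' * a + g t0 * b * S') ((- 2 * g t0 * b) *\<^sub>R (x0 - y)) X"
proof -
  define \<xi> where "\<xi> = x0 - y"
  obtain \<gamma> where \<gamma>: "\<And>t. g t = g t0 + \<gamma> t * (t - t0)" "isCont \<gamma> t0" "\<gamma> t0 = g'"
    by (rule DERIV_obtain_factor[OF g]) (rule that)
  obtain \<zeta> where \<zeta>: "\<And>t. S t = S t0 + \<zeta> t * (t - t0)" "isCont \<zeta> t0" "\<zeta> t0 = S'"
    by (rule DERIV_obtain_factor[OF S]) (rule that)
  define d where "d z = \<zeta> (fst z) * (fst z - t0) - 2 * (\<xi> \<bullet> (snd z - x0)) - (norm (snd z - x0))\<^sup>2" for z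
  have cont_fst: "isCont (\<lambda>z. \<gamma> (fst z)) (t0, x0)" "isCont (\<lambda>z. \<zeta> (fst z)) (t0, x0)"
    by (simp_all add: isCont_compose_fst \<gamma> \<zeta>)
  have cont_d: "isCont d (t0, x0)"
    unfolding d_def[abs_def] by (intro continuous_intros cont_fst)
  have d0: "d (t0, x0) = 0"
    by (simp add: d_def)
  have cont_\<epsilon>: "isCont (\<lambda>z. \<epsilon> (w + d z)) (t0, x0)"
    by (rule isCont_o2[where g = \<epsilon>]) (auto simp: d0 \<epsilon> intro: continuous_add cont_d)
  have arg: "S (fst z) - (norm (snd z - y))\<^sup>2 = w + d z" for z
  proof -
    have "(norm (snd z - y))\<^sup>2 = (norm \<xi>)\<^sup>2 + 2 * (\<xi> \<bullet> (snd z - x0)) + (norm (snd z - x0))\<^sup>2"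
      using norm_add_squared[of \<xi> "snd z - x0"] by (simp add: \<xi>_def)
    then show ?thesis
      by (simp add: w d_def \<zeta>(1)[of "fst z"] \<xi>_def[symmetric])
  qed
  have quad: "(X *v h) \<bullet> h = g t0 * (- 2 * b * (norm h)\<^sup>2 + 8 * c * (\<xi> \<bullet> h)\<^sup>2)" for h
    unfolding X \<xi>_def[symmetric] rank_one_perturbation_mult
    by (simp add: inner_simps dot_square_norm power2_eq_square algebra_simps)
  have sym: "transpose X = X"
    by (simp add: X transpose_rank_one_perturbation)
  \<comment> \<open>Write \<tau> and h for the time and space increments and q for
    \<open>\<xi> \<bullet> h\<close>. Then \<open>e\<close> is the cofactor in
    \<open>d^2 - 4 q^2 = (\<zeta> \<tau> - |h|^2) e\<close>. The Hessian cancels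
    \<open>4 c q^2\<close>, so the remainder splits into \<open>A\<close> times \<tau>,
    \<open>B\<close> times \<open>|h|^2\<close> and a multiple of \<open>\<epsilon> q^2\<close>,
    each with a coefficient tending to zero.\<close>
  define e where "e z = \<zeta> (fst z) * (fst z - t0) - (norm (snd z - x0))\<^sup>2 - 4 * (\<xi> \<bullet> (snd z - x0))" for z
  define A where "A z = (\<gamma> (fst z) - g') * a + \<gamma> (fst z) * (b * d z + (c + \<epsilon> (w + d z)) * (d z)\<^sup>2)
     + g t0 * b * (\<zeta> (fst z) - S') + g t0 * (c + \<epsilon> (w + d z)) * \<zeta> (fst z) * e z" for z
  define B where "B z = g t0 * (c + \<epsilon> (w + d z)) * e z" for z
  have A0: "((\<lambda>z. \<bar>A z\<bar>) \<longlongrightarrow> 0) (at (t0, x0))" and B0: "((\<lambda>z. \<bar>B z\<bar>) \<longlongrightarrow> 0) (at (t0, x0))"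
    and E0: "((\<lambda>z. 4 * \<bar>g t0\<bar> * \<bar>\<epsilon> (w + d z)\<bar> * (norm \<xi>)\<^sup>2) \<longlongrightarrow> 0) (at (t0, x0))"
  proof -
    have ce: "isCont e (t0, x0)"
      unfolding e_def[abs_def] by (intro continuous_intros cont_fst)
    have "isCont (\<lambda>z. \<bar>A z\<bar>) (t0, x0)" "isCont (\<lambda>z. \<bar>B z\<bar>) (t0, x0)"
      "isCont (\<lambda>z. 4 * \<bar>g t0\<bar> * \<bar>\<epsilon> (w + d z)\<bar> * (norm \<xi>)\<^sup>2) (t0, x0)"
      unfolding A_def B_def by (intro continuous_intros cont_fst cont_d cont_\<epsilon> ce)+
    then show "((\<lambda>z. \<bar>A z\<bar>) \<longlongrightarrow> 0) (at (t0, x0))" "((\<lambda>z. \<bar>B z\<bar>) \<longlongrightarrow> 0) (at (t0, x0))"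
      "((\<lambda>z. 4 * \<bar>g t0\<bar> * \<bar>\<epsilon> (w + d z)\<bar> * (norm \<xi>)\<^sup>2) \<longlongrightarrow> 0) (at (t0, x0))"
      by (auto simp: isCont_def A_def B_def d0 \<epsilon> \<gamma>(3) \<zeta>(3) e_def)
  qed
  define M where "M z = \<bar>A z\<bar> + \<bar>B z\<bar> + 4 * \<bar>g t0\<bar> * \<bar>\<epsilon> (w + d z)\<bar> * (norm \<xi>)\<^sup>2" for z
  have M0: "(M \<longlongrightarrow> 0) (at (t0, x0))"
    unfolding M_def[abs_def] using tendsto_add[OF tendsto_add[OF A0 B0] E0] by simp
  let ?r = "\<lambda>(t, x). g t * F (S t - (norm (x - y))\<^sup>2) - g t0 * F (S t0 - (norm (x0 - y))\<^sup>2)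
      - (g' * a + g t0 * b * S') * (t - t0) - ((- 2 * g t0 * b) *\<^sub>R (x0 - y)) \<bullet> (x - x0)
                - 1/2 * ((X *v (x - x0)) \<bullet> (x - x0))"
  have rem: "?r z = A z * (fst z - t0) - B z * (norm (snd z - x0))\<^sup>2
      + 4 * g t0 * \<epsilon> (w + d z) * (\<xi> \<bullet> (snd z - x0))\<^sup>2" for z
  proof -
    define \<tau> h q G Z n2 E where abbr: "\<tau> = fst z - t0" "h = snd z - x0" "q = \<xi> \<bullet> h"
      "G = \<gamma> (fst z)" "Z = \<zeta> (fst z)" "n2 = (norm h)\<^sup>2" "E = \<epsilon> (w + d z)"
    have dz: "d z = Z * \<tau> - 2 * q - n2" and ez: "e z = Z * \<tau> - n2 - 4 * q"
      by (simp_all add: d_def e_def abbr)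
    have *: "F (w + d z) = a + b * d z + (c + E) * (d z)\<^sup>2" "F w = a" "g (fst z) = g t0 + G * \<tau>"
      by (subst F, simp add: abbr, subst F, simp, subst \<gamma>(1), simp add: abbr)
    have "?r z = g (fst z) * F (S (fst z) - (norm (snd z - y))\<^sup>2) - g t0 * F (S t0 - (norm (x0 - y))\<^sup>2)
        - (g' * a + g t0 * b * S') * \<tau> - ((- 2 * g t0 * b) *\<^sub>R \<xi>) \<bullet> h - 1/2 * ((X *v h) \<bullet> h)"
      by (simp only: case_prod_unfold abbr \<xi>_def)
    also have "\<dots> = (g t0 + G * \<tau>) * (a + b * d z + (c + E) * (d z)\<^sup>2) - g t0 * a
       - (g' * a + g t0 * b * S') * \<tau> + 2 * g t0 * b * q - g t0 * (- b * n2 + 4 * c * q\<^sup>2)"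
      unfolding arg w[symmetric] quad * inner_scaleR_left
      by (simp add: abbr(3,6)[symmetric] algebra_simps)
    also have "\<dots> = A z * \<tau> - B z * n2 + 4 * g t0 * E * q\<^sup>2"
      unfolding A_def B_def abbr(4,5,7)[symmetric] unfolding dz ez by algebra
    finally show ?thesis
      by (simp add: abbr)
  qed
  have "?r \<in> o[at (t0, x0)](\<lambda>(t, x). \<bar>t - t0\<bar> + (norm (x - x0))\<^sup>2)"
  proof (rule smallo_if_bounded_by_null_factor[OF M0], intro always_eventually allI)
    fix z :: "real \<times> (real^'n)"
    let ?h = "snd z - x0"
    let ?n = "\<bar>fst z - t0\<bar> + (norm ?h)\<^sup>2"
    have "(\<xi> \<bullet> ?h)\<^sup>2 \<le> (norm \<xi>)\<^sup>2 * (norm ?h)\<^sup>2"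
      using Cauchy_Schwarz_ineq[of \<xi> ?h] by (simp add: power2_norm_eq_inner)
    also have "\<dots> \<le> (norm \<xi>)\<^sup>2 * ?n"
      by (intro mult_left_mono) auto
    finally have 3: "\<bar>4 * g t0 * \<epsilon> (w + d z) * (\<xi> \<bullet> ?h)\<^sup>2\<bar> \<le> 4 * \<bar>g t0\<bar> * \<bar>\<epsilon> (w + d z)\<bar> * ((norm \<xi>)\<^sup>2 * ?n)"
      by (simp add: abs_mult mult_left_mono)
    have 1: "\<bar>A z * (fst z - t0)\<bar> \<le> \<bar>A z\<bar> * ?n"
      by (simp add: abs_mult mult_left_mono)
    have 2: "\<bar>B z * (norm ?h)\<^sup>2\<bar> \<le> \<bar>B z\<bar> * ?n"
      by (simp add: abs_mult mult_left_mono)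
    have "\<bar>?r z\<bar> \<le> M z * ?n"
    proof -
      have "\<bar>P - Q + R\<bar> \<le> P' + Q' + R'" if "\<bar>P\<bar> \<le> P'" "\<bar>Q\<bar> \<le> Q'" "\<bar>R\<bar> \<le> R'" for P Q R P' Q' R' :: real
        using that by linarith
      from this[OF 1 2 3] show ?thesis
        unfolding rem M_def by (simp only: distrib_right mult.assoc)
    qed
    then show "\<bar>?r z\<bar> \<le> M z * \<bar>case z of (t, x) \<Rightarrow> \<bar>t - t0\<bar> + (norm (x - x0))\<^sup>2\<bar>"
      by (simp add: case_prod_unfold)
  qed
  then show ?thesis
    using sym by (simp add: parabolic_taylor_def)
qed

section \<open>Comparison with a barrier that is smooth where it exceeds the solution\<close>

text \<open>A penalty that is singular at \<open>T\<close> places the negative minimum of the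
  penalized difference at an intermediate time, where \<open>v\<close> plus the penalty touches
  \<open>u\<close> from below. The penalty strictly lowers the time slope, so the weak inequality on
  the jets of \<open>v\<close> already contradicts the supersolution property. Initial and lateral
  contact are excluded by \<open>init\<close> and by the interior condition in
  \<open>taylor\<close>.\<close>

lemma parabolic_comparison:
  fixes u v :: "real \<times> (real^'n) \<Rightarrow> real"
  assumes jets: "\<And>z s p X. z \<in> Q \<Longrightarrow> (s, p, X) \<in> parabolic_subjet Q u z \<Longrightarrow> infinity_laplacian_op p X \<le> s"
    and K: "compact K" and T: "t0 < T"
    and cu: "continuous_on ({t0..T} \<times> K) u" and cv: "continuous_on ({t0..T} \<times> K) v"
    and init: "\<And>x. x \<in> K \<Longrightarrow> v (t0, x) \<le> u (t0, x)"
    and taylor: "\<And>t x. t0 < t \<Longrightarrow> t < T \<Longrightarrow> x \<in> K \<Longrightarrow> u (t, x) < v (t, x) \<Longrightarrow>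
        x \<in> interior K \<and> (t, x) \<in> Q \<and> (\<exists>s p X. parabolic_taylor v t x s p X \<and> s \<le> infinity_laplacian_op p X)"
    and x: "x \<in> K"
  shows "v (T, x) \<le> u (T, x)"
proof -
  have before: "v (t1, x1) \<le> u (t1, x1)" if t1: "t1 \<in> {t0..<T}" and x1: "x1 \<in> K" for t1 x1
  proof (rule ccontr)
    assume neg: "\<not> v (t1, x1) \<le> u (t1, x1)"
    \<comment> \<open>This makes the penalty \<open>\<eta> / (T - t)\<close> at time
      \<open>t1\<close> half of the gap at \<open>(t1, x1)\<close>, so the penalized difference
      \<open>f\<close> is still negative there.\<close>
    define \<eta> where "\<eta> = (v (t1, x1) - u (t1, x1)) * (T - t1) / 2"
    have \<eta>: "\<eta> > 0"
      using neg t1 by (auto simp: \<eta>_def)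
    obtain M where M: "M > 0" "\<And>t x. t \<in> {t0..T} \<Longrightarrow> x \<in> K \<Longrightarrow> v (t, x) - u (t, x) \<le> M"
    proof -
      have "compact ({t0..T} \<times> K)"
        by (intro compact_Times K compact_Icc)
      then have "bounded ((\<lambda>z. v z - u z) ` ({t0..T} \<times> K))"
        by (intro compact_imp_bounded compact_continuous_image continuous_intros cu cv)
      then obtain M where "M > 0" "\<forall>y\<in>(\<lambda>z. v z - u z) ` ({t0..T} \<times> K). norm y \<le> M"
        by (auto simp: bounded_pos)
      then show thesis
        by (intro that[of M]) (auto dest!: bspec)
    qed
    \<comment> \<open>At \<open>T1\<close> the penalty is at least \<open>M + 1\<close>, which
      outweighs any gap and keeps the minimum off the last slice; the first bound keeps
      \<open>t1\<close> before \<open>T1\<close>.\<close>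
    define \<delta> where "\<delta> = min ((T - t1) / 2) (\<eta> / (M + 1))"
    define T1 where "T1 = T - \<delta>"
    have \<delta>: "\<delta> > 0" "t1 < T1" "T1 < T"
      using t1 M(1) \<eta> by (auto simp: \<delta>_def T1_def min_def field_simps)
    have \<eta>\<delta>: "\<eta> / \<delta> \<ge> M + 1"
    proof -
      have "\<delta> \<le> \<eta> / (M + 1)"
        by (simp add: \<delta>_def)
      then show ?thesis
        using \<delta>(1) M(1) by (simp add: field_simps)
    qed
    define k where "k t = - (\<eta> / (T - t))" for t
    define f where "f z = u z - (v z + k (fst z))" for z :: "real \<times> (real^'n)"
    have k_neg: "k t < 0" if "t < T" for t
      using that \<eta> by (simp add: k_def)
    have sub: "{t0..T1} \<times> K \<subseteq> {t0..T} \<times> K"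
      using \<delta> by auto
    have "continuous_on ({t0..T1} \<times> K) f"
      unfolding f_def[abs_def] k_def using \<delta>
      by (intro continuous_intros continuous_on_subset[OF cu sub] continuous_on_subset[OF cv sub]) auto
    moreover have "compact ({t0..T1} \<times> K)" "{t0..T1} \<times> K \<noteq> {}"
      using K x1 t1 \<delta> by (auto intro: compact_Times)
    ultimately obtain zs where zs: "zs \<in> {t0..T1} \<times> K" "\<And>z. z \<in> {t0..T1} \<times> K \<Longrightarrow> f zs \<le> f z"
      using continuous_attains_inf by metis
    obtain ts xs where zs_eq: "zs = (ts, xs)"
      by (cases zs)
    have ts: "ts \<in> {t0..T1}" "xs \<in> K"
      using zs by (auto simp: zs_eq)
    have "k t1 = - ((v (t1, x1) - u (t1, x1)) / 2)"
      using t1 by (simp add: k_def \<eta>_def del: right_diff_distrib_numeral)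
    then have "f (t1, x1) < 0"
      using neg unfolding f_def by simp argo
    then have f_neg: "f (ts, xs) < 0"
      using zs(2)[of "(t1, x1)"] t1 x1 \<delta> by (auto simp: zs_eq)
    have "ts \<noteq> t0"
      using f_neg init[OF ts(2)] k_neg[of ts] T by (auto simp: f_def)
    moreover have "ts \<noteq> T1"
    proof
      assume "ts = T1"
      then have "f (ts, xs) \<ge> 1"
        using \<eta>\<delta> M(2)[of T1 xs] ts \<delta> by (auto simp: f_def k_def T1_def)
      then show False
        using f_neg by simp
    qed
    ultimately have ts': "t0 < ts" "ts < T1" "ts < T"
      using ts \<delta> by auto
    have "u (ts, xs) < v (ts, xs)"
      using f_neg k_neg[OF ts'(3)] by (simp add: f_def)
    then obtain s p X where loc: "xs \<in> interior K" "(ts, xs) \<in> Q"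
      and jet: "parabolic_taylor v ts xs s p X" "s \<le> infinity_laplacian_op p X"
      using taylor[of ts xs] ts ts' by blast
    have "(k has_real_derivative - (\<eta> / (T - ts)\<^sup>2)) (at ts)"
      unfolding k_def[abs_def] using ts'
      by (auto intro!: derivative_eq_intros simp: power2_eq_square)
    then have "parabolic_taylor (\<lambda>(t, x). v (t, x) + k t) ts xs (s + - (\<eta> / (T - ts)\<^sup>2)) p X"
      by (rule parabolic_taylor_add_time[OF jet(1)])
    moreover have "\<forall>\<^sub>F z in at (ts, xs). u (ts, xs) + (case z of (t, x) \<Rightarrow> v (t, x) + k t)
        - (case (ts, xs) of (t, x) \<Rightarrow> v (t, x) + k t) \<le> u z"
    proof -
      have "open ({t0<..<T1} \<times> interior K)" "(ts, xs) \<in> {t0<..<T1} \<times> interior K"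
        using loc ts' by (auto intro: open_Times)
      then have "\<forall>\<^sub>F z in at (ts, xs). z \<in> {t0<..<T1} \<times> interior K"
        by (rule eventually_at_in_open')
      then show ?thesis
      proof eventually_elim
        case (elim z)
        then have "f (ts, xs) \<le> f z"
          using zs(2)[of z] interior_subset[of K] by (auto simp: zs_eq)
        then show ?case
          by (auto simp: f_def split: prod.split)
      qed
    qed
    ultimately have "(s + - (\<eta> / (T - ts)\<^sup>2), p, X) \<in> parabolic_subjet Q u (ts, xs)"
      by (rule parabolic_subjet_if_touching)
    then have "infinity_laplacian_op p X \<le> s - \<eta> / (T - ts)\<^sup>2"
      using jets[OF loc(2)] by fastforce
    moreover have "\<eta> / (T - ts)\<^sup>2 > 0"
      using \<eta> ts' by simp
    ultimately show False
      using jet(2) by simp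
  qed
  \<comment> \<open>The penalty is infinite at \<open>T\<close>, so the final time is reached by
    continuity from earlier times.\<close>
  have "continuous_on {t0..T} (\<lambda>t. u (t, x) - v (t, x))"
    using x by (intro continuous_intros continuous_on_compose2[OF cu] continuous_on_compose2[OF cv]) auto
  then have "continuous_on (closure {t0..<T}) (\<lambda>t. u (t, x) - v (t, x))" "T \<in> closure {t0..<T}"
    using T by auto
  then have "0 \<le> u (T, x) - v (T, x)"
    by (rule continuous_ge_on_closure) (use before x in auto)
  then show ?thesis
    by simp
qed

section \<open>The profile of the barrier\<close>

text \<open>With \<open>\<sigma> = s^2\<close> and \<open>w = s0^2\<close> the expansion becomes
  polynomial in \<open>s\<close> and \<open>s0\<close>, and the remainder gains a factor
  \<open>s - s0\<close>. The result has the form that \<open>parabolic_taylor_radial\<close> asks of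
  \<open>F\<close>.\<close>

lemma three_halves_power_taylor:
  assumes "0 < w"
  obtains \<epsilon> where "isCont \<epsilon> w" "\<epsilon> w = 0"
    and "\<And>\<sigma>. max 0 \<sigma> * sqrt (max 0 \<sigma>)
          = w * sqrt w + 3/2 * sqrt w * (\<sigma> - w) + (3 / (8 * sqrt w) + \<epsilon> \<sigma>) * (\<sigma> - w)\<^sup>2"
proof -
  define s0 where "s0 = sqrt w"
  have s0: "s0 > 0" "w = s0\<^sup>2"
    using assms by (simp_all add: s0_def)
  \<comment> \<open>Solving the expansion for its error makes it exact for every \<sigma>; only
    continuity at \<open>w\<close> is left, and near \<open>w\<close> the error equals the closed
    form \<open>E\<close>.\<close>
  define \<epsilon> where "\<epsilon> \<sigma> = (if \<sigma> = w then 0 else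
    (max 0 \<sigma> * sqrt (max 0 \<sigma>) - w * s0 - 3/2 * s0 * (\<sigma> - w)) / (\<sigma> - w)\<^sup>2 - 3 / (8 * s0))" for \<sigma>
  define E where "E \<sigma> = - ((sqrt \<sigma> - s0) / 2 + 3 * (sqrt \<sigma> - s0)\<^sup>2 / (8 * s0)) / (sqrt \<sigma> + s0)\<^sup>2" for \<sigma>
  have "isCont E w"
    unfolding E_def[abs_def] s0_def using assms by (intro continuous_intros) auto
  then have "(E \<longlongrightarrow> 0) (at w)"
    by (auto simp: isCont_def E_def s0_def)
  moreover have "\<forall>\<^sub>F \<sigma> in at w. \<epsilon> \<sigma> = E \<sigma>"
  proof -
    have "\<forall>\<^sub>F \<sigma> in at w. \<sigma> \<in> {0<..}"
      using assms by (intro eventually_at_in_open') auto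
    moreover have "\<forall>\<^sub>F \<sigma> in at w. \<sigma> \<noteq> w"
      by (simp add: eventually_at_filter)
    ultimately show ?thesis
    proof eventually_elim
      case (elim \<sigma>)
      define s where "s = sqrt \<sigma>"
      have s: "s > 0" "\<sigma> = s\<^sup>2"
        using elim by (simp_all add: s_def)
      have ne: "s \<noteq> s0" "s + s0 \<noteq> 0" "s0 \<noteq> 0"
        using elim s s0 by auto
      have "8 * s0 * (s\<^sup>2 * s - s0\<^sup>2 * s0 - 3/2 * s0 * (s\<^sup>2 - s0\<^sup>2)) - 3 * (s\<^sup>2 - s0\<^sup>2)\<^sup>2
          = - (4 * s0 * (s - s0) + 3 * (s - s0)\<^sup>2) * (s - s0)\<^sup>2"
        by algebra
      moreover have sq: "(s\<^sup>2 - s0\<^sup>2)\<^sup>2 = (s - s0)\<^sup>2 * (s + s0)\<^sup>2"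
        by algebra
      ultimately have "(s\<^sup>2 * s - s0\<^sup>2 * s0 - 3/2 * s0 * (s\<^sup>2 - s0\<^sup>2)) / (s\<^sup>2 - s0\<^sup>2)\<^sup>2 - 3 / (8 * s0)
          = - (4 * s0 * (s - s0) + 3 * (s - s0)\<^sup>2) * (s - s0)\<^sup>2 / (8 * s0 * ((s - s0)\<^sup>2 * (s + s0)\<^sup>2))"
        using ne by (simp add: diff_frac_eq sq mult_ac)
      also have "\<dots> = - (4 * s0 * (s - s0) + 3 * (s - s0)\<^sup>2) / (8 * s0 * (s + s0)\<^sup>2)"
        using ne by (simp add: mult_ac)
      also have "\<dots> = - ((s - s0) / 2 + 3 * (s - s0)\<^sup>2 / (8 * s0)) / (s + s0)\<^sup>2"
      proof -
        have "- (4 * s0 * e + 3 * e\<^sup>2) / (8 * s0 * k) = - (e / 2 + 3 * e\<^sup>2 / (8 * s0)) / k"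
          if "k \<noteq> 0" for e k
          using that ne(3) by (simp add: divide_simps)
        from this[of "(s + s0)\<^sup>2" "s - s0"] ne show ?thesis
          by simp
      qed
      finally show ?case
        using elim s by (simp add: \<epsilon>_def E_def s_def[symmetric] s0(2))
    qed
  qed
  ultimately have "(\<epsilon> \<longlongrightarrow> 0) (at w)"
    by (simp add: tendsto_cong)
  then have "isCont \<epsilon> w"
    by (simp add: isCont_def \<epsilon>_def)
  moreover have "max 0 \<sigma> * sqrt (max 0 \<sigma>)
      = w * sqrt w + 3/2 * sqrt w * (\<sigma> - w) + (3 / (8 * sqrt w) + \<epsilon> \<sigma>) * (\<sigma> - w)\<^sup>2" for \<sigma>
    using assms by (simp add: \<epsilon>_def s0_def[symmetric] max_def)
  moreover have "\<epsilon> w = 0"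
    by (simp add: \<epsilon>_def)
  ultimately show thesis
    by (intro that)
qed

text \<open>The vector \<xi> is an eigenvector of the matrix, with eigenvalue
  \<open>\<alpha> + \<beta> * (norm \<xi>)\<^sup>2\<close>.\<close>

lemma infinity_laplacian_rank_one_perturbation:
  "infinity_laplacian_op (\<mu> *\<^sub>R \<xi>) (rank_one_perturbation \<alpha> \<beta> \<xi>)
     = \<mu>\<^sup>2 * (norm \<xi>)\<^sup>2 * (\<alpha> + \<beta> * (norm \<xi>)\<^sup>2)"
  by (simp add: infinity_laplacian_op_def rank_one_perturbation_mult inner_simps dot_square_norm
      power2_eq_square algebra_simps)

text \<open>The time after which the barrier below, with the fastest admissible growth of its
  support and initially below \<open>m\<close> on the ball of radius \<open>r\<close>, has support of radius \<open>R\<close>.\<close>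

definition spreading_time :: "real \<Rightarrow> real \<Rightarrow> real \<Rightarrow> real" where
  "spreading_time r R m = r^6 / m\<^sup>2 * (exp (9 * R\<^sup>2 * (R\<^sup>2 - r\<^sup>2) / r^4) - 1) / (162 * R\<^sup>2)"

lemma spreading_time_pos:
  assumes "0 < r" "r < R" "0 < m"
  shows "0 < spreading_time r R m"
proof -
  have "r\<^sup>2 < R\<^sup>2"
    using assms by (simp add: power_strict_mono)
  then have "0 < 9 * R\<^sup>2 * (R\<^sup>2 - r\<^sup>2) / r^4"
    using assms by simp
  then show ?thesis
    using assms by (simp add: spreading_time_def)
qed

lemma closure_cylinder: "closure (cylinder \<Omega>) = {0..} \<times> closure \<Omega>"
  by (simp add: cylinder_def closure_Times)

section \<open>Spreading of positivity between concentric balls\<close>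

text \<open>With \<open>n = |x - y|^2\<close> and \<open>w = S - n\<close>, time derivative and
  infinity-Laplacian of the barrier share the factor \<open>g^3 sqrt w\<close>. The subsolution
  inequality thus reduces to \<open>3 \<alpha> K - K w \<le> 27 n (n - w)\<close>: a small \<alpha>
  secures it at the front \<open>w = 0\<close>, a large \<open>K\<close> inside the support.\<close>

lemma positivity_spreads:
  fixes u :: "real \<times> (real^'n) \<Rightarrow> real"
  assumes super: "viscosity_supersolution \<Omega> u0 u"
    and cont: "continuous_on (closure (cylinder \<Omega>)) u"
    and nonneg: "\<And>z. z \<in> closure (cylinder \<Omega>) \<Longrightarrow> 0 \<le> u z"
    and r: "0 < r" "r < R" and ball: "ball y R \<subseteq> \<Omega>" and m: "0 < m"
    and t0: "0 \<le> t0" and init: "\<And>x. x \<in> cball y r \<Longrightarrow> m \<le> u (t0, x)"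
    and T: "t0 + spreading_time r R m \<le> T" and x: "x \<in> ball y R"
  shows "0 < u (T, x)"
proof -
  \<comment> \<open>The factor 81 lets \<open>K w\<close> absorb the cross term
    \<open>81 S w\<close>, because \<open>S\<close> stays below \<open>R\<^sup>2\<close>. The choice
    of \<open>A\<close> gives the initial barrier the peak value
    \<open>r^3 / sqrt A = m\<close>.\<close>
  define K where "K = 81 * R\<^sup>2"
  define A where "A = r^6 / m\<^sup>2"
  define q where "q t = A + 2 * K * (t - t0)" for t
  define \<alpha> where "\<alpha> = (R\<^sup>2 - r\<^sup>2) / ln (q T / A)"
  define S where "S t = r\<^sup>2 + \<alpha> * ln (q t / A)" for t
  define F where "F \<sigma> = max 0 \<sigma> * sqrt (max 0 \<sigma>)" for \<sigma> :: real
  define v where "v = (\<lambda>(t, x). 1 / sqrt (q t) * F (S t - (norm (x - y))\<^sup>2))"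
  have R: "R > 0" "r\<^sup>2 < R\<^sup>2" and K: "K > 0" and A: "A > 0"
    using r m by (simp_all add: K_def A_def power_strict_mono)
  have "t0 < T"
    using spreading_time_pos[OF r m] T by simp
  have q_pos: "q t > 0" "q t \<ge> A" if "t \<ge> t0" for t
    using that K A by (simp_all add: q_def add_pos_nonneg)
  have "A * exp (9 * R\<^sup>2 * (R\<^sup>2 - r\<^sup>2) / r^4) \<le> q T"
  proof -
    have "2 * K * spreading_time r R m = A * (exp (9 * R\<^sup>2 * (R\<^sup>2 - r\<^sup>2) / r^4) - 1)"
      using R by (simp add: spreading_time_def K_def A_def)
    moreover have "2 * K * spreading_time r R m \<le> 2 * K * (T - t0)"
      using K T by simp
    ultimately show ?thesis
      by (simp add: q_def algebra_simps)
  qed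
  then have "exp (9 * R\<^sup>2 * (R\<^sup>2 - r\<^sup>2) / r^4) \<le> q T / A"
    using A by (simp add: field_simps)
  then have L: "9 * R\<^sup>2 * (R\<^sup>2 - r\<^sup>2) / r^4 \<le> ln (q T / A)"
    using q_pos[of T] A \<open>t0 < T\<close> by (simp add: ln_ge_iff)
  moreover have "0 < 9 * R\<^sup>2 * (R\<^sup>2 - r\<^sup>2) / r^4"
    using R r by simp
  ultimately have L_pos: "0 < ln (q T / A)"
    by linarith
  have \<alpha>: "0 < \<alpha>"
    using L_pos R by (simp add: \<alpha>_def)
  \<comment> \<open>The waiting time is calibrated for this bound, which amounts to
    \<open>3 \<alpha> K \<le> 27 r^4\<close>. A later \<open>T\<close> makes \<alpha> smaller, so
    the bound persists.\<close>
  have \<alpha>_le: "9 * R\<^sup>2 * \<alpha> \<le> r^4"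
    using L L_pos r R by (simp add: \<alpha>_def field_simps)
  \<comment> \<open>\<open>\<alpha>\<close> is chosen so that the support reaches radius \<open>R\<close> exactly at time \<open>T\<close>\<close>
  have S_T: "S T = R\<^sup>2"
    using L_pos by (simp add: S_def \<alpha>_def)
  have S_bounds: "r\<^sup>2 \<le> S t" "S t \<le> R\<^sup>2" if "t \<in> {t0..T}" for t
  proof -
    have "q t \<le> q T"
      using that K by (simp add: q_def)
    then have "ln (q t / A) \<le> ln (q T / A)"
      using q_pos[of t] q_pos[of T] that A by (simp add: divide_right_mono)
    then have "\<alpha> * ln (q t / A) \<le> \<alpha> * ln (q T / A)"
      using \<alpha> by simp
    then show "S t \<le> R\<^sup>2"
      using S_T by (simp add: S_def)
    show "r\<^sup>2 \<le> S t"
      using q_pos[of t] that A \<alpha> by (simp add: S_def)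
  qed
  have F_nonpos: "F \<sigma> = 0" if "\<sigma> \<le> 0" for \<sigma>
    using that by (simp add: F_def)
  have cball_sub: "cball y R \<subseteq> closure \<Omega>"
    using closure_mono[OF ball] R by simp
  have "v (T, x) \<le> u (T, x)"
  proof (rule parabolic_comparison[where ?t0.0 = t0 and K = "cball y R" and Q = "cylinder \<Omega>"])
    show "infinity_laplacian_op p X \<le> s" if "z \<in> cylinder \<Omega>" "(s, p, X) \<in> parabolic_subjet (cylinder \<Omega>) u z"
      for z s p X
      using super that unfolding viscosity_supersolution_def by fastforce
    show "continuous_on ({t0..T} \<times> cball y R) u"
      using cball_sub t0 by (intro continuous_on_subset[OF cont]) (auto simp: closure_cylinder)
    show "continuous_on ({t0..T} \<times> cball y R) v"
    proof -
      have "q (fst z) \<noteq> 0" if "z \<in> {t0..T} \<times> cball y R" for z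
        using that q_pos[of "fst z"] by fastforce
      moreover have "continuous_on ({t0..T} \<times> cball y R) (\<lambda>z. q (fst z))"
        unfolding q_def by (intro continuous_intros)
      ultimately show ?thesis
        unfolding v_def case_prod_unfold F_def S_def using A
        by (intro continuous_intros) auto
    qed
    show "v (t0, z) \<le> u (t0, z)" if "z \<in> cball y R" for z
    proof (cases "z \<in> cball y r")
      case True
      have "S t0 - (norm (z - y))\<^sup>2 \<le> r\<^sup>2"
        using A by (simp add: S_def q_def)
      then have "F (S t0 - (norm (z - y))\<^sup>2) \<le> r\<^sup>2 * sqrt (r\<^sup>2)"
        unfolding F_def by (intro mult_mono real_sqrt_le_mono) auto
      also have "\<dots> = r ^ 3"
        using r by (simp add: power3_eq_cube power2_eq_square)
      finally have "v (t0, z) \<le> 1 / sqrt A * r ^ 3"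
        using A by (simp add: v_def q_def divide_right_mono)
      also have "sqrt A = r ^ 3 / m"
        unfolding A_def using r m by (intro real_sqrt_unique) (auto simp: power_divide simp flip: power_mult)
      also have "1 / (r ^ 3 / m) * r ^ 3 = m"
        using r by simp
      finally show ?thesis
        using init[OF True] by simp
    next
      case False
      then have "r\<^sup>2 \<le> (norm (z - y))\<^sup>2"
        using r by (intro power_mono) (auto simp: dist_norm norm_minus_commute)
      then have "S t0 - (norm (z - y))\<^sup>2 \<le> 0"
        using A by (simp add: S_def q_def)
      then have "v (t0, z) = 0"
        by (simp add: v_def F_nonpos)
      then show ?thesis
        using nonneg[of "(t0, z)"] that cball_sub t0 by (auto simp: closure_cylinder)
    qed
    show "z \<in> interior (cball y R) \<and> (t, z) \<in> cylinder \<Omega> \<and>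
        (\<exists>s p X. parabolic_taylor v t z s p X \<and> s \<le> infinity_laplacian_op p X)"
      if t: "t0 < t" "t < T" and z: "z \<in> cball y R" and less: "u (t, z) < v (t, z)" for t z
    proof -
      define w where "w = S t - (norm (z - y))\<^sup>2"
      \<comment> \<open>As \<open>u\<close> is nonnegative, the barrier can exceed it only inside
        its own support; there the profile is smooth, and the support lies within radius
        \<open>R\<close> up to time \<open>T\<close>.\<close>
      have "0 < v (t, z)"
        using less nonneg[of "(t, z)"] z cball_sub t t0 by (fastforce simp: closure_cylinder)
      then have w: "0 < w"
        using F_nonpos[of w] by (force simp: v_def w_def)
      then have "(norm (z - y))\<^sup>2 < R\<^sup>2"
        using S_bounds(2)[of t] t by (simp add: w_def)
      then have z_ball: "z \<in> ball y R"
        using R by (simp add: dist_norm norm_minus_commute power_less_imp_less_base)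
      define s0 where "s0 = sqrt w"
      have s0: "s0 > 0" "w = s0\<^sup>2"
        using w by (simp_all add: s0_def)
      define g where "g = 1 / sqrt (q t)"
      have qt: "q t > 0"
        using q_pos t by simp
      have g: "g > 0" "g\<^sup>2 = 1 / q t"
        using qt by (simp_all add: g_def power_divide)
      obtain \<epsilon> where \<epsilon>: "isCont \<epsilon> w" "\<epsilon> w = 0"
        and F: "\<And>\<sigma>. F \<sigma> = w * s0 + 3/2 * s0 * (\<sigma> - w) + (3 / (8 * s0) + \<epsilon> \<sigma>) * (\<sigma> - w)\<^sup>2"
        using three_halves_power_taylor[OF w] unfolding F_def s0_def by metis
      have dq: "(q has_real_derivative 2 * K) (at t)"
        unfolding q_def[abs_def] by (auto intro!: derivative_eq_intros)
      have dS: "(S has_real_derivative 2 * \<alpha> * K * g\<^sup>2) (at t)"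
        unfolding S_def[abs_def] using qt A
        by (auto intro!: derivative_eq_intros dq simp: g)
      have dg: "((\<lambda>t. 1 / sqrt (q t)) has_real_derivative - K * g * g\<^sup>2) (at t)"
        using qt by (auto intro!: derivative_eq_intros dq simp: g g_def field_simps)
      define p where "p = (- 2 * g * (3/2 * s0)) *\<^sub>R (z - y)"
      define X where "X = rank_one_perturbation (- 2 * g * (3/2 * s0)) (8 * g * (3 / (8 * s0))) (z - y)"
      define s where "s = - K * g * g\<^sup>2 * (w * s0) + g * (3/2 * s0) * (2 * \<alpha> * K * g\<^sup>2)"
      have "parabolic_taylor v t z s p X"
        unfolding v_def s_def p_def X_def g_def
        by (rule parabolic_taylor_radial[OF dg[unfolded g_def] dS[unfolded g_def] w_def F \<epsilon> refl])
      moreover have "s \<le> infinity_laplacian_op p X"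
      proof -
        define n where "n = (norm (z - y))\<^sup>2"
        have n: "n = S t - w" "n \<ge> 0"
          by (simp_all add: n_def w_def)
        have St: "r\<^sup>2 \<le> S t" "S t \<le> R\<^sup>2"
          using S_bounds t by auto
        have "infinity_laplacian_op p X = (3 * g * s0)\<^sup>2 * n * (- 3 * g * s0 + 3 * g / s0 * n)"
          unfolding p_def X_def infinity_laplacian_rank_one_perturbation n_def[symmetric]
          by (simp add: power2_eq_square)
        also have "\<dots> = g ^ 3 * s0 * (27 * n * (n - w))"
          using s0 by (simp add: field_simps power2_eq_square power3_eq_cube)
        finally have lap: "infinity_laplacian_op p X = g ^ 3 * s0 * (27 * n * (n - w))" .
        have "s = g ^ 3 * s0 * (3 * \<alpha> * K - K * w)"
          by (simp add: s_def power2_eq_square power3_eq_cube algebra_simps)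
        \<comment> \<open>Substituting \<open>n = S - w\<close> turns the right side into
          \<open>27 S^2 - 81 S w + 54 w^2\<close>. The first term dominates
          \<open>3 \<alpha> K\<close>, the second is at least \<open>- K w\<close>, and the third is
          nonnegative.\<close>
        moreover have "3 * \<alpha> * K - K * w \<le> 27 * n * (n - w)"
        proof -
          have "3 * \<alpha> * K \<le> 27 * r ^ 4"
            using \<alpha>_le by (simp add: K_def mult_ac)
          also have "r ^ 4 \<le> (S t)\<^sup>2"
            using power_mono[OF St(1), of 2] by (simp flip: power_mult)
          finally have 1: "3 * \<alpha> * K \<le> 27 * (S t)\<^sup>2"
            by simp
          have 2: "81 * (S t * w) \<le> K * w"
            using St(2) w by (simp add: K_def)
          have "27 * n * (n - w) = 27 * (S t)\<^sup>2 - 81 * (S t * w) + 54 * w\<^sup>2"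
            unfolding n(1) by algebra
          then show ?thesis
            using 1 2 zero_le_power2[of w] by linarith
        qed
        ultimately show ?thesis
          unfolding lap using g s0 by (simp add: mult_left_mono)
      qed
      ultimately show ?thesis
        using z_ball ball t t0 by (auto simp: cylinder_def interior_cball)
    qed
    show "x \<in> cball y R"
      using x by simp
  qed (use \<open>t0 < T\<close> in auto)
  moreover have "0 < v (T, x)"
  proof -
    have "(norm (x - y))\<^sup>2 < R\<^sup>2"
      using x by (intro power_strict_mono) (auto simp: dist_norm norm_minus_commute)
    then show ?thesis
      using q_pos[of T] \<open>t0 < T\<close> by (simp add: v_def F_def S_T)
  qed
  ultimately show ?thesis
    by simp
qed

text \<open>Qualitative form for chaining: the minimum of \<open>u\<close> over the closed ball
  serves as \<open>m\<close>, and every time after the waiting time is admissible.\<close>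

lemma positivity_spreads_compact:
  fixes u :: "real \<times> (real^'n) \<Rightarrow> real"
  assumes super: "viscosity_supersolution \<Omega> u0 u"
    and cont: "continuous_on (closure (cylinder \<Omega>)) u"
    and nonneg: "\<And>z. z \<in> closure (cylinder \<Omega>) \<Longrightarrow> 0 \<le> u z"
    and r: "0 < r" "r < R" and ball: "ball y R \<subseteq> \<Omega>" and t0: "0 \<le> t0"
    and pos: "\<And>x. x \<in> cball y r \<Longrightarrow> 0 < u (t0, x)"
  shows "\<exists>T>0. \<forall>t\<ge>T. \<forall>x\<in>ball y R. 0 < u (t, x)"
proof -
  have "cball y r \<subseteq> closure \<Omega>"
    using ball r closure_subset[of \<Omega>] by (auto simp: subset_iff)
  then have "continuous_on (cball y r) (\<lambda>x. u (t0, x))"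
    using t0 by (intro continuous_on_compose2[OF cont] continuous_intros) (auto simp: closure_cylinder)
  then obtain x0 where x0: "x0 \<in> cball y r" "\<And>x. x \<in> cball y r \<Longrightarrow> u (t0, x0) \<le> u (t0, x)"
    using continuous_attains_inf[of "cball y r" "\<lambda>x. u (t0, x)"] r by auto
  define T where "T = t0 + spreading_time r R (u (t0, x0))"
  have "T > 0"
    using spreading_time_pos[OF r pos[OF x0(1)]] t0 by (simp add: T_def)
  moreover have "0 < u (t, x)" if "T \<le> t" "x \<in> ball y R" for t x
    using positivity_spreads[OF super cont nonneg r ball pos[OF x0(1)] t0 x0(2)] that by (simp add: T_def)
  ultimately show ?thesis
    by blast
qed

section \<open>Geometry of the sphere conditions\<close>

text \<open>Disjointness puts the centres at distance at least \<open>R + S\<close>, while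
  \<open>x0\<close> lies at distances \<open>R\<close> and \<open>S\<close> from them. Equality in
  the triangle inequality places \<open>x0\<close> on the segment between the centres.\<close>

lemma touching_balls_collinear:
  fixes e y x0 :: "'a::euclidean_space"
  assumes "0 < R" "0 < S" "dist x0 e = R" "dist y x0 = S" and disj: "ball e R \<inter> ball y S = {}"
  shows "y - x0 = (S / R) *\<^sub>R (x0 - e)"
proof -
  have "R + S \<le> dist e y"
  proof (rule ccontr)
    assume less: "\<not> R + S \<le> dist e y"
    \<comment> \<open>The point dividing the segment in the ratio \<open>R : S\<close> lies in both
      balls if the centres are too close.\<close>
    define z where "z = e + (R / (R + S)) *\<^sub>R (y - e)"
    have "dist e z = R / (R + S) * dist e y"
      using assms(1,2) by (simp add: z_def dist_norm norm_minus_commute)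
    also have "\<dots> < R / (R + S) * (R + S)"
      using less assms(1,2) by (intro mult_strict_left_mono) auto
    finally have "z \<in> ball e R"
      using assms(1,2) by simp
    have "y - z = (1 - R / (R + S)) *\<^sub>R (y - e)"
      by (simp add: z_def algebra_simps)
    also have "1 - R / (R + S) = S / (R + S)"
      using assms(1,2) by (simp add: field_simps)
    finally have "dist y z = S / (R + S) * dist e y"
      using assms(1,2) by (simp add: dist_norm norm_minus_commute)
    also have "\<dots> < S / (R + S) * (R + S)"
      using less assms(1,2) by (intro mult_strict_left_mono) auto
    finally have "z \<in> ball y S"
      using assms(1,2) by simp
    with \<open>z \<in> ball e R\<close> disj show False
      by blast
  qed
  moreover have "dist e y = norm ((x0 - e) + (y - x0))" "norm (x0 - e) = R" "norm (y - x0) = S"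
    using assms by (simp_all add: dist_norm norm_minus_commute)
  ultimately have "norm ((x0 - e) + (y - x0)) = norm (x0 - e) + norm (y - x0)"
    using norm_triangle_ineq[of "x0 - e" "y - x0"] by simp
  then have "R *\<^sub>R (y - x0) = S *\<^sub>R (x0 - e)"
    using norm_triangle_eq[of "x0 - e" "y - x0"] \<open>norm (x0 - e) = R\<close> \<open>norm (y - x0) = S\<close> by simp
  then have "(1 / R) *\<^sub>R (R *\<^sub>R (y - x0)) = (1 / R) *\<^sub>R (S *\<^sub>R (x0 - e))"
    by simp
  then show ?thesis
    using assms(1) by simp
qed

text \<open>At a nearest boundary point the exterior ball forces the interior ball and the largest ball
  around \<open>x\<close> to have the same inner normal.\<close>

lemma covered_by_interior_balls:
  fixes \<Omega> :: "(real^'n) set"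
  assumes "open \<Omega>" "\<Omega> \<noteq> {}" "bounded \<Omega>"
    and ext: "uniform_exterior_sphere \<Omega>" and int: "uniform_interior_sphere \<Omega>"
  obtains R0 where "0 < R0" "\<And>x. x \<in> \<Omega> \<Longrightarrow> \<exists>y. ball y R0 \<subseteq> \<Omega> \<and> x \<in> ball y R0"
proof -
  obtain R where R: "R > 0"
    "\<And>x0. x0 \<in> frontier \<Omega> \<Longrightarrow> \<exists>e. dist x0 e = R \<and> ball e R \<inter> \<Omega> = {}"
    using ext unfolding uniform_exterior_sphere_def by blast
  obtain R0 where R0: "R0 > 0"
    "\<And>x0. x0 \<in> frontier \<Omega> \<Longrightarrow> \<exists>y\<in>\<Omega>. dist y x0 = R0 \<and> ball y R0 \<subseteq> \<Omega>"
    using int unfolding uniform_interior_sphere_def by blast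
  have "frontier \<Omega> \<noteq> {}"
    using assms(2,3) not_bounded_UNIV by (auto simp: frontier_eq_empty)
  have "\<exists>y. ball y R0 \<subseteq> \<Omega> \<and> x \<in> ball y R0" if x: "x \<in> \<Omega>" for x
  proof -
    obtain x0 where x0: "x0 \<in> frontier \<Omega>" "\<And>z. z \<in> frontier \<Omega> \<Longrightarrow> dist x x0 \<le> dist x z"
      using distance_attains_inf[OF frontier_closed \<open>frontier \<Omega> \<noteq> {}\<close>] by metis
    define d where "d = dist x x0"
    have "x \<noteq> x0"
      using x x0(1) assms(1) by (auto simp: frontier_def interior_open)
    then have d: "d > 0"
      by (simp add: d_def)
    have sub: "ball x d \<subseteq> \<Omega>"
    proof (rule ccontr)
      assume "\<not> ball x d \<subseteq> \<Omega>"
      then have "ball x d \<inter> frontier \<Omega> \<noteq> {}"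
        using x d centre_in_ball[of x d] by (intro connected_Int_frontier connected_ball) blast+
      then show False
        using x0(2) by (force simp: d_def)
    qed
    show ?thesis
    proof (cases "R0 \<le> d")
      case True
      then have "ball x R0 \<subseteq> \<Omega>"
        using sub by (auto simp: subset_iff)
      then show ?thesis
        using R0(1) by (intro exI[of _ x]) simp
    next
      case False
      obtain e where e: "dist x0 e = R" "ball e R \<inter> \<Omega> = {}"
        using R(2) x0(1) by blast
      obtain y where y: "dist y x0 = R0" "ball y R0 \<subseteq> \<Omega>"
        using R0(2) x0(1) by blast
      have "x - x0 = (d / R) *\<^sub>R (x0 - e)"
        using e sub d R(1) by (intro touching_balls_collinear) (auto simp: d_def)
      moreover have "y - x0 = (R0 / R) *\<^sub>R (x0 - e)"
        using e y R0(1) R(1) by (intro touching_balls_collinear) auto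
      moreover have "y - x = (y - x0) - (x - x0)"
        by simp
      \<comment> \<open>Both \<open>x\<close> and \<open>y\<close> lie on the ray from
        \<open>x0\<close> away from \<open>e\<close>, at distances \<open>d\<close> and
        \<open>R0\<close>, hence they are \<open>R0 - d\<close> apart.\<close>
      ultimately have "y - x = ((R0 - d) / R) *\<^sub>R (x0 - e)"
        by (simp only: diff_divide_distrib scaleR_diff_left)
      then have "dist y x = R0 - d"
        using e(1) R(1) False by (simp add: dist_norm)
      then show ?thesis
        using y(2) d by (intro exI[of _ y]) simp
    qed
  qed
  with R0(1) show thesis
    by (rule that)
qed

section \<open>Eventual positivity on the whole domain\<close>

theorem lemma4p1:
  fixes \<Omega> :: "(real^'n) set" and u0 :: "real^'n \<Rightarrow> real" and u :: "real \<times> (real^'n) \<Rightarrow> real"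
  assumes "open \<Omega>" and "connected \<Omega>" and "\<Omega> \<noteq> {}" and "bounded \<Omega>"
    and "uniform_exterior_sphere \<Omega>" and "uniform_interior_sphere \<Omega>"
    and "u0 \<in> C0_closure \<Omega>"
    and "\<forall>x\<in>closure \<Omega>. u0 x \<ge> 0" and "\<exists>x\<in>closure \<Omega>. u0 x \<noteq> 0"
    and "viscosity_solution \<Omega> u0 u"
    and "\<forall>z\<in>closure (cylinder \<Omega>). u z \<ge> 0"
  shows "\<exists>t1>0. \<forall>t\<ge>t1. \<forall>x\<in>\<Omega>. u (t, x) > 0"
proof -
  have super: "viscosity_supersolution \<Omega> u0 u" and cont: "continuous_on (closure (cylinder \<Omega>)) u"
    using assms(10) by (auto simp: viscosity_solution_def)
  have nonneg: "0 \<le> u z" if "z \<in> closure (cylinder \<Omega>)" for z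
    using assms(11) that by blast
  note spreads = positivity_spreads_compact[OF super cont nonneg]
  \<comment> \<open>A neighbourhood is built into \<open>P\<close> so that positivity can start a
    new spreading step and compactness can later yield a common time.\<close>
  define P where "P x \<longleftrightarrow> (\<exists>\<rho>>0. \<exists>T>0. \<forall>t\<ge>T. \<forall>x'\<in>ball x \<rho>. 0 < u (t, x'))" for x

  obtain a where a: "a \<in> \<Omega>" "P a"
  proof -
    obtain a where a: "a \<in> closure \<Omega>" "u0 a \<noteq> 0"
      using assms(9) by blast
    then have "a \<notin> frontier \<Omega>"
      using assms(7) by (auto simp: C0_closure_def)
    then have a_in: "a \<in> \<Omega>"
      using a(1) assms(1) by (simp add: frontier_def interior_open)
    have "u0 a > 0"
      using assms(8) a by (simp add: less_le)
    then have ua: "u (0, a) > 0"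
      using super a(1) by (fastforce simp: viscosity_supersolution_def)
    have "continuous_on \<Omega> (\<lambda>x. u (0, x))"
      using closure_subset[of \<Omega>]
      by (intro continuous_on_compose2[OF cont] continuous_intros) (auto simp: closure_cylinder)
    then have "open {x \<in> \<Omega>. 0 < u (0, x)}"
      using continuous_open_preimage[OF _ assms(1) open_greaterThan[of 0]] by (simp add: vimage_def Int_def)
    then obtain R where R: "R > 0" "ball a R \<subseteq> {x \<in> \<Omega>. 0 < u (0, x)}"
      using a_in ua open_contains_ball by blast
    have "cball a (R / 2) \<subseteq> ball a R"
      using R(1) by auto
    then have "\<exists>T>0. \<forall>t\<ge>T. \<forall>x\<in>ball a R. 0 < u (t, x)"
      using R by (intro spreads[of "R / 2" _ _ 0]) auto
    then show thesis
      using R(1) a_in that[of a] by (auto simp: P_def)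
  qed

  have P: "P x" if "x \<in> \<Omega>" for x
  proof (rule connected_induction_simple[OF assms(2) a(1) that, where P = P])
    fix c assume "c \<in> \<Omega>"
    then obtain \<delta>4 where "\<delta>4 > 0" "ball c \<delta>4 \<subseteq> \<Omega>"
      using assms(1) open_contains_ball by blast
    \<comment> \<open>With a quarter of the radius, for any \<open>z\<close> and \<open>z'\<close>
      in \<open>ball c \<delta>\<close> the ball of radius \<open>3 * \<delta>\<close> around
      \<open>z\<close> stays in \<Omega> and contains \<open>ball z' \<delta>\<close>. So one
      spreading step carries \<open>P\<close> from \<open>z\<close> to \<open>z'\<close>.\<close>
    define \<delta> where "\<delta> = \<delta>4 / 4"
    have \<delta>: "\<delta> > 0" "ball c (4 * \<delta>) \<subseteq> \<Omega>"
      using \<open>\<delta>4 > 0\<close> \<open>ball c \<delta>4 \<subseteq> \<Omega>\<close> by (simp_all add: \<delta>_def)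
    have "P z'" if z: "z \<in> ball c \<delta>" "z' \<in> ball c \<delta>" and "P z" for z z'
    proof -
      obtain \<rho> T where \<rho>: "\<rho> > 0" "T > 0" "\<And>t x. T \<le> t \<Longrightarrow> x \<in> ball z \<rho> \<Longrightarrow> 0 < u (t, x)"
        using \<open>P z\<close> unfolding P_def by blast
      define r where "r = min (\<rho> / 2) \<delta>"
      have r: "0 < r" "r < \<rho>" "r < 3 * \<delta>"
        using \<rho>(1) \<delta>(1) by (auto simp: r_def)
      have "ball z (3 * \<delta>) \<subseteq> ball c (4 * \<delta>)"
        using z(1) by (subst ball_subset_ball_iff) (simp add: dist_commute)
      moreover have "ball z' \<delta> \<subseteq> ball z (3 * \<delta>)"
        using z dist_triangle[of z' z c] by (subst ball_subset_ball_iff) (simp add: dist_commute)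
      moreover have "\<exists>T>0. \<forall>t\<ge>T. \<forall>x\<in>ball z (3 * \<delta>). 0 < u (t, x)"
      proof (rule spreads)
        show "0 < r" "r < 3 * \<delta>" "0 \<le> T" "ball z (3 * \<delta>) \<subseteq> \<Omega>"
          using r \<rho>(2) \<delta>(2) calculation(1) by simp_all
        show "0 < u (T, x)" if "x \<in> cball z r" for x
          using that r(2) by (intro \<rho>(3)) auto
      qed
      ultimately obtain T' where "T' > 0" "\<forall>t\<ge>T'. \<forall>x\<in>ball z' \<delta>. 0 < u (t, x)"
        by (meson subsetD)
      then show "P z'"
        unfolding P_def using \<delta>(1) by blast
    qed
    then show "\<exists>T. openin (top_of_set \<Omega>) T \<and> c \<in> T \<and> (\<forall>x\<in>T. \<forall>y\<in>T. P x \<longrightarrow> P y)"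
    proof (intro exI[of _ "ball c \<delta>"] conjI)
      have "ball c \<delta> \<subseteq> ball c (4 * \<delta>)"
        using \<delta>(1) by (intro subset_ball) simp
      then show "openin (top_of_set \<Omega>) (ball c \<delta>)"
        using \<delta>(2) by (intro open_subset) auto
    qed (use \<delta>(1) in simp, blast)
  qed (fact a)

  obtain R0 where R0: "R0 > 0" "\<And>x. x \<in> \<Omega> \<Longrightarrow> \<exists>y. ball y R0 \<subseteq> \<Omega> \<and> x \<in> ball y R0"
    using covered_by_interior_balls[OF assms(1,3,4,5,6)] by blast
  \<comment> \<open>The compact core. With the radius \<open>R0 / 2\<close> it contains the
    concentric half of every ball of radius \<open>R0\<close> inside \<Omega>.\<close>
  define D where "D = {x. ball x (R0 / 2) \<subseteq> \<Omega>}"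
  have D_sub: "D \<subseteq> \<Omega>"
    using R0(1) by (auto simp: D_def subset_iff)
  have "compact D"
  proof -
    have "D = (\<Inter>z\<in>- \<Omega>. {x. R0 / 2 \<le> dist x z})"
      by (force simp: D_def subset_iff not_le)
    then have "closed D"
      by (auto intro!: closed_INT closed_Collect_le continuous_intros)
    then show ?thesis
      using D_sub assms(4) bounded_subset compact_eq_bounded_closed by blast
  qed
  obtain T where T: "T > 0" "\<And>x. x \<in> D \<Longrightarrow> 0 < u (T, x)"
  proof -
    obtain \<rho> \<tau> where \<rho>: "\<And>x. x \<in> \<Omega> \<Longrightarrow> \<rho> x > 0"
      "\<And>x t x'. x \<in> \<Omega> \<Longrightarrow> \<tau> x \<le> t \<Longrightarrow> x' \<in> ball x (\<rho> x) \<Longrightarrow> 0 < u (t, x')"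
      using P unfolding P_def by metis
    obtain C where C: "C \<subseteq> D" "finite C" "D \<subseteq> (\<Union>x\<in>C. ball x (\<rho> x))"
    proof (rule compactE_image[OF \<open>compact D\<close>, of D "\<lambda>x. ball x (\<rho> x)"])
      show "D \<subseteq> (\<Union>x\<in>D. ball x (\<rho> x))"
        using \<rho>(1) D_sub by force
    qed auto
    \<comment> \<open>A finite subcover gives a common time; the inserted 1 keeps \<open>T\<close>
      positive and the set nonempty.\<close>
    define T where "T = Max (insert 1 (\<tau> ` C))"
    have "1 \<le> T" "\<And>x. x \<in> C \<Longrightarrow> \<tau> x \<le> T"
      using C(2) by (auto simp: T_def)
    moreover have "0 < u (T, x)" if "x \<in> D" for x
      using that C D_sub calculation(2) \<rho>(2) by blast
    ultimately show thesis
      using that[of T] by simp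
  qed
  have core: "cball y (R0 / 2) \<subseteq> D" if "ball y R0 \<subseteq> \<Omega>" for y
  proof
    fix z assume "z \<in> cball y (R0 / 2)"
    then have "ball z (R0 / 2) \<subseteq> ball y R0"
      by (auto simp: ball_subset_ball_iff dist_commute)
    then show "z \<in> D"
      using that by (auto simp: D_def)
  qed
  have "D \<noteq> {}"
    using assms(3) R0 core by fastforce
  moreover have "continuous_on D (\<lambda>x. u (T, x))"
    using T(1) D_sub closure_subset[of \<Omega>]
    by (intro continuous_on_compose2[OF cont] continuous_intros) (auto simp: closure_cylinder)
  ultimately obtain x0 where x0: "x0 \<in> D" "\<And>x. x \<in> D \<Longrightarrow> u (T, x0) \<le> u (T, x)"
    using continuous_attains_inf[OF \<open>compact D\<close>] by metis
  \<comment> \<open>One lower bound on the whole core gives one waiting time for all interior balls,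
    however close to the boundary they reach.\<close>
  define m where "m = u (T, x0)"
  have m: "m > 0"
    using T(2) x0(1) by (simp add: m_def)
  have R0': "0 < R0 / 2" "R0 / 2 < R0"
    using R0(1) by simp_all
  show ?thesis
  proof (intro exI[of _ "T + spreading_time (R0 / 2) R0 m"] conjI allI impI ballI)
    show "T + spreading_time (R0 / 2) R0 m > 0"
      using T(1) spreading_time_pos[OF R0' m] by simp
    fix t x assume t: "T + spreading_time (R0 / 2) R0 m \<le> t" and "x \<in> \<Omega>"
    then obtain y where y: "ball y R0 \<subseteq> \<Omega>" "x \<in> ball y R0"
      using R0(2) by blast
    have "m \<le> u (T, x')" if "x' \<in> cball y (R0 / 2)" for x'
      using x0(2) core[OF y(1)] that by (auto simp: m_def)
    then show "0 < u (t, x)"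
      using T(1) t y by (intro positivity_spreads[OF super cont nonneg R0' y(1) m, of T]) auto
  qed
qed

end
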